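(* Let $N \geq 2$ and let $v_1, \dots, v_N \in \mathbb{C}^r$ form an equiangular tight frame. Let $V \in \mathbb{C}^{r \times N}$ be the matrix whose columns are the $v_i$, and define $R = (|V|^{\odot 2})(|V|^{\odot 2})^\top \in \mathbb{R}^{r \times r}$, with entries $R_{k\ell} = \sum_{i=1}^N |(v_i)_k|^2 |(v_i)_\ell|^2$. Then $$R \preceq \frac{1 - \frac{1}{r}}{1 - \frac{1}{N}} I_r + \frac{\frac{N}{r} - 1}{r\left(1 - \frac{1}{N}\right)} \mathbf{1}\mathbf{1}^\top.$$
   Context: Unit vectors $v_1, \dots, v_N \in \mathbb{C}^r$ form a unit norm tight frame (UNTF) if $\sum_{i=1}^N v_i v_i^* = \frac{N}{r} I_r$. They form an equiangular tight frame (ETF) if moreover there exists $\alpha \in [0,1]$ such that $|\langle v_i, v_j \rangle| = \alpha$ whenever $i \neq j$. For a matrix $M$, $|M|^{\odot 2}$ denotes the matrix of entrywise squared absolute values. $\mathbf{1} \in \mathbb{R}^r$ is the all-ones vector, and $A \preceq B$ means that $B - A$ is positive semidefinite. *)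

theory Defs
  imports "HOL-Analysis.Analysis"
begin

text \<open>
  The inner product \<open>(\<bullet>)\<close> that the library puts on \<^typ>\<open>complex ^ 'r\<close> is the real part of the
  Hermitian one, so the Hermitian inner product is defined here. The norm of
  \<^typ>\<open>complex ^ 'r\<close> is the usual Euclidean one and is used for ``unit vector''.
\<close>

definition hinner :: "complex ^ 'r \<Rightarrow> complex ^ 'r \<Rightarrow> complex"
  where "hinner x y = (\<Sum>k\<in>UNIV. x $ k * cnj (y $ k))"

definition outer :: "complex ^ 'r \<Rightarrow> complex ^ 'r \<Rightarrow> complex ^ 'r ^ 'r"
  where "outer x y = (\<chi> k l. x $ k * cnj (y $ l))"

definition untf :: "('n::finite \<Rightarrow> complex ^ 'r) \<Rightarrow> bool"
  where "untf v \<longleftrightarrow> (\<forall>i. norm (v i) = 1) \<and>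
    (\<Sum>i\<in>UNIV. outer (v i) (v i)) = (real CARD('n) / real CARD('r)) *\<^sub>R mat 1"

definition etf :: "('n::finite \<Rightarrow> complex ^ 'r) \<Rightarrow> bool"
  where "etf v \<longleftrightarrow> untf v \<and>
    (\<exists>\<alpha>::real. 0 \<le> \<alpha> \<and> \<alpha> \<le> 1 \<and> (\<forall>i j. i \<noteq> j \<longrightarrow> cmod (hinner (v i) (v j)) = \<alpha>))"

definition abs_sq_matrix :: "complex ^ 'n ^ 'm \<Rightarrow> real ^ 'n ^ 'm"
  where "abs_sq_matrix M = map_matrix (\<lambda>z. (cmod z)\<^sup>2) M"

text \<open>
  The type annotation matters: \<^const>\<open>columnvector\<close> leaves its number of (repeated) columns
  unspecified, and the outer product needs exactly one.
\<close>

definition ones_matrix :: "real ^ 'r ^ 'r"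
  where "ones_matrix = (columnvector 1 :: real ^ 1 ^ 'r) ** (rowvector 1 :: real ^ 'r ^ 1)"

lemma ones_matrix_entries: "ones_matrix $ k $ l = 1"
  by (simp add: ones_matrix_def matrix_matrix_mult_def columnvector_def rowvector_def)

definition psd :: "real ^ 'r ^ 'r \<Rightarrow> bool"
  where "psd A \<longleftrightarrow> transpose A = A \<and> (\<forall>x. 0 \<le> x \<bullet> (A *v x))"

definition loewner_le :: "real ^ 'r ^ 'r \<Rightarrow> real ^ 'r ^ 'r \<Rightarrow> bool"  (infix \<open>\<preceq>\<close> 50)
  where "A \<preceq> B \<longleftrightarrow> psd (B - A)"

definition frame_matrix :: "('n::finite \<Rightarrow> complex ^ 'r) \<Rightarrow> complex ^ 'n ^ 'r"
  where "frame_matrix v = (\<chi> k i. v i $ k)"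

lemma column_frame_matrix: "column i (frame_matrix v) = v i"
  by (simp add: column_def frame_matrix_def vec_eq_iff)

lemma abs_sq_gram_entries:
  fixes v :: "'n::finite \<Rightarrow> complex ^ 'r"
  shows "(abs_sq_matrix (frame_matrix v) ** transpose (abs_sq_matrix (frame_matrix v))) $ k $ l
    = (\<Sum>i\<in>UNIV. (cmod (v i $ k))\<^sup>2 * (cmod (v i $ l))\<^sup>2)"
  by (simp add: matrix_matrix_mult_def transpose_def abs_sq_matrix_def frame_matrix_def)

end

theory Submission
  imports Defs
begin

text \<open>
  For a real vector \<open>x\<close>, the quadratic form of \<open>R\<close> at \<open>x\<close> is the sum of the squares of
  \<open>\<Sum>\<^sub>k |(v\<^sub>i)\<^sub>k|\<^sup>2 x\<^sub>k\<close> over \<open>i\<close>, and this inner sum is the Frobenius inner product of the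
  projection \<open>v\<^sub>i v\<^sub>i\<^sup>*\<close> with the diagonal matrix of \<open>x\<close>. The projections of an equiangular tight
  frame have equal pairwise inner products \<open>\<alpha>\<^sup>2\<close> and sum to a multiple of the identity, so their
  traceless parts \<open>A\<^sub>i = v\<^sub>i v\<^sub>i\<^sup>* - I/r\<close>, each of squared norm \<open>1 - 1/r\<close>, are the vertices of a
  regular simplex centred at the origin. The vertices of such a simplex form a tight frame of their
  span, so \<open>\<Sum>\<^sub>i \<langle>A\<^sub>i, D\<rangle>\<^sup>2 \<le> (1 - 1/r)/(1 - 1/N) \<parallel>D\<parallel>\<^sup>2\<close> for every matrix \<open>D\<close>
  (lemma \<open>simplex_frame_bound\<close>).

  Now split \<open>x\<close> into its mean, which is a multiple of \<open>\<one>\<close>, and a part \<open>z\<close> of sum zero. The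
  simplex bound with the diagonal matrix of \<open>z\<close> controls the second part
  (lemma \<open>etf_diagonal_bound\<close>), the vector \<open>\<one>\<close> is handled exactly by the unit norms, and the
  cross term vanishes because the \<open>A\<^sub>i\<close> sum to zero. Adding up gives the claim; the coefficient of
  \<open>\<one>\<one>\<^sup>\<top>\<close> is what the constant vectors leave over, namely
  \<open>N/r\<^sup>2 - (1/r) (1 - 1/r)/(1 - 1/N)\<close>.
\<close>

text \<open>
  A form of Bessel's inequality: the operator \<open>d \<mapsto> \<Sum>\<^sub>i \<langle>A\<^sub>i, d\<rangle> A\<^sub>i\<close> and the Gram matrix of the
  \<open>A\<^sub>i\<close> have the same nonzero eigenvalues. It suffices to bound the Gram form at the coefficient
  vector of \<open>d\<close>; Cauchy--Schwarz for \<open>\<Sum>\<^sub>i \<langle>A\<^sub>i, d\<rangle> A\<^sub>i\<close> against \<open>d\<close> gives the rest.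
\<close>

lemma bessel_from_gram_bound:
  fixes A :: "'i \<Rightarrow> 'a::real_inner"
  assumes gram: "(norm (\<Sum>i\<in>I. (A i \<bullet> d) *\<^sub>R A i))\<^sup>2 \<le> c * (\<Sum>i\<in>I. (A i \<bullet> d)\<^sup>2)"
    and c: "0 \<le> c"
  shows "(\<Sum>i\<in>I. (A i \<bullet> d)\<^sup>2) \<le> c * (norm d)\<^sup>2"
proof -
  let ?S = "\<Sum>i\<in>I. (A i \<bullet> d)\<^sup>2" and ?P = "\<Sum>i\<in>I. (A i \<bullet> d) *\<^sub>R A i"
  have S: "?P \<bullet> d = ?S"
    by (simp add: inner_sum_left power2_eq_square)
  have "?S * ?S \<le> (norm ?P)\<^sup>2 * (norm d)\<^sup>2"
    using Cauchy_Schwarz_ineq[of ?P d] by (simp only: S power2_norm_eq_inner flip: power2_eq_square)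
  also have "\<dots> \<le> (c * ?S) * (norm d)\<^sup>2"
    by (rule mult_right_mono[OF gram]) simp
  finally have "?S * ?S \<le> ?S * (c * (norm d)\<^sup>2)"
    by (simp add: mult_ac)
  moreover have "0 \<le> ?S"
    by (simp add: sum_nonneg)
  ultimately show ?thesis
    using c by (cases "?S = 0") (auto simp: mult_le_cancel_left)
qed

text \<open>
  For a centred regular simplex, pairing one vertex with the sum of all determines the common inner
  product as \<open>q = -p / (N - 1)\<close>. The coefficients \<open>\<langle>A\<^sub>i, d\<rangle>\<close> sum to zero because the vertices do,
  and on coefficient vectors of sum zero the Gram matrix acts as the scalar
  \<open>p - q = p / (1 - 1/N)\<close>.
\<close>

lemma simplex_frame_bound:
  fixes A :: "'n::finite \<Rightarrow> 'a::real_inner"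
  assumes norms: "\<And>i. A i \<bullet> A i = p"
    and angles: "\<And>i j. i \<noteq> j \<Longrightarrow> A i \<bullet> A j = q"
    and centred: "(\<Sum>i\<in>UNIV. A i) = 0"
    and card: "CARD('n) \<ge> 2"
  shows "(\<Sum>i\<in>UNIV. (A i \<bullet> d)\<^sup>2) \<le> p / (1 - 1 / real CARD('n)) * (norm d)\<^sup>2"
proof -
  let ?N = "real CARD('n)"
  have gram: "A i \<bullet> A j = q + (if j = i then p - q else 0)" for i j
    using norms angles by auto
  have "0 = A i \<bullet> (\<Sum>j\<in>UNIV. A j)" for i
    by (simp add: centred)
  then have "?N * q + (p - q) = 0"
    by (simp add: inner_sum_right gram sum.distrib)
  then have q: "p - q = p / (1 - 1 / ?N)"
    using card by (simp add: field_simps)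
  have "0 \<le> p"
    using norms[of undefined] inner_ge_zero[of "A undefined"] by simp
  then have nonneg: "0 \<le> p - q"
    unfolding q by simp
  have sum0: "(\<Sum>i\<in>UNIV. A i \<bullet> d) = 0"
    using centred by (simp flip: inner_sum_left)
  have weighted: "(A j \<bullet> d) * (A j \<bullet> A i) = (A j \<bullet> d) * q + (if j = i then (A i \<bullet> d) * (p - q) else 0)"
    for i j
    by (auto simp: gram distrib_left)
  have "(norm (\<Sum>i\<in>UNIV. (A i \<bullet> d) *\<^sub>R A i))\<^sup>2
      = (\<Sum>i\<in>UNIV. \<Sum>j\<in>UNIV. (A i \<bullet> d) * ((A j \<bullet> d) * (A j \<bullet> A i)))"
    by (simp add: power2_norm_eq_inner inner_sum_left inner_sum_right sum_distrib_left)
  also have "\<dots> = (\<Sum>i\<in>UNIV. (A i \<bullet> d) * ((\<Sum>j\<in>UNIV. A j \<bullet> d) * q + (A i \<bullet> d) * (p - q)))"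
    by (simp only: weighted sum.distrib sum_distrib_left[symmetric] sum_distrib_right[symmetric])
      simp
  also have "\<dots> = (p - q) * (\<Sum>i\<in>UNIV. (A i \<bullet> d)\<^sup>2)"
    by (simp add: sum0 sum_distrib_left power2_eq_square mult_ac)
  finally show ?thesis
    using bessel_from_gram_bound[of A d UNIV "p - q"] nonneg by (simp add: q)
qed

text \<open>
  The inner product on \<^typ>\<open>complex ^ 'r ^ 'r\<close> is the real part of the Frobenius inner product.
  Between Hermitian matrices the latter is already real, and for two projections it is
  \<open>tr (v v\<^sup>* w w\<^sup>*) = |\<langle>v, w\<rangle>|\<^sup>2\<close>. This is how the moduli of equiangular vectors become angles in a
  real inner product space.
\<close>

lemma inner_outer_outer:
  fixes v w :: "complex ^ 'r"
  shows "outer v v \<bullet> outer w w = (cmod (hinner v w))\<^sup>2"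
proof -
  have "complex_of_real ((cmod (hinner v w))\<^sup>2) = hinner v w * cnj (hinner v w)"
    by (rule complex_norm_square)
  also have "\<dots> = (\<Sum>k\<in>UNIV. \<Sum>l\<in>UNIV. (v $ k * cnj (v $ l)) * cnj (w $ k * cnj (w $ l)))"
    by (simp add: hinner_def sum_product mult_ac)
  finally have "(cmod (hinner v w))\<^sup>2
      = Re (\<Sum>k\<in>UNIV. \<Sum>l\<in>UNIV. (v $ k * cnj (v $ l)) * cnj (w $ k * cnj (w $ l)))"
    by (metis Re_complex_of_real)
  moreover have "x \<bullet> y = Re (x * cnj y)" for x y :: complex
    by (simp add: inner_complex_def)
  ultimately show ?thesis
    by (simp only: inner_vec_def outer_def vec_lambda_beta Re_sum)
qed

definition diag_matrix :: "real ^ 'r \<Rightarrow> complex ^ 'r ^ 'r"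
  where "diag_matrix x = (\<chi> k l. if l = k then complex_of_real (x $ k) else 0)"

lemma diag_matrix_1: "diag_matrix 1 = mat 1"
  by (simp add: diag_matrix_def mat_def vec_eq_iff)

lemma inner_outer_diag_matrix:
  "outer v v \<bullet> diag_matrix x = (\<Sum>k\<in>UNIV. (cmod (v $ k))\<^sup>2 * x $ k)"
proof -
  have "(v $ k * cnj (v $ l)) \<bullet> (if l = k then complex_of_real (x $ k) else 0)
      = (if l = k then (cmod (v $ k))\<^sup>2 * x $ k else 0)" for k l
    by (simp add: inner_complex_def cmod_power2 distrib_right flip: power2_eq_square)
  then show ?thesis
    by (simp add: inner_vec_def outer_def diag_matrix_def)
qed

lemma inner_diag_matrix: "diag_matrix x \<bullet> diag_matrix y = x \<bullet> y"
proof -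
  have "(if l = k then complex_of_real (x $ k) else 0)
      \<bullet> (if l = k then complex_of_real (y $ k) else 0)
      = (if l = k then x $ k * y $ k else 0)" for k l
    by (simp add: inner_complex_def)
  then show ?thesis
    by (simp add: inner_vec_def diag_matrix_def)
qed

lemma sum_cmod_square_unit:
  fixes v :: "complex ^ 'r"
  assumes "norm v = 1"
  shows "(\<Sum>k\<in>UNIV. (cmod (v $ k))\<^sup>2) = 1"
  using assms by (simp add: norm_vec_def L2_set_def)

text \<open>
  The traceless parts of the projections are the simplex. A diagonal matrix \<open>D\<close> of trace zero is
  orthogonal to the identity, so its inner products with the \<open>v\<^sub>i v\<^sub>i\<^sup>*\<close> and with their traceless
  parts coincide. The inner products with \<open>D\<close> sum to zero because the traceless parts do.
\<close>

lemma etf_diagonal_bound: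
  fixes v :: "'n::finite \<Rightarrow> complex ^ 'r" and z :: "real ^ 'r"
  assumes etf: "etf v"
    and card: "CARD('n) \<ge> 2"
    and z: "(\<Sum>k\<in>UNIV. z $ k) = 0"
  shows "(\<Sum>i\<in>UNIV. (\<Sum>k\<in>UNIV. (cmod (v i $ k))\<^sup>2 * z $ k)\<^sup>2)
      \<le> (1 - 1 / real CARD('r)) / (1 - 1 / real CARD('n)) * (norm z)\<^sup>2" (is ?bound)
    and "(\<Sum>i\<in>UNIV. \<Sum>k\<in>UNIV. (cmod (v i $ k))\<^sup>2 * z $ k) = 0" (is ?sum)
proof -
  let ?r = "real CARD('r)"
  define A where "A i = outer (v i) (v i) - (1 / ?r) *\<^sub>R mat 1" for i
  obtain \<alpha> where \<alpha>: "\<And>i j. i \<noteq> j \<Longrightarrow> cmod (hinner (v i) (v j)) = \<alpha>"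
    using etf unfolding etf_def by blast
  have unit: "norm (v i) = 1" for i
    using etf by (simp add: etf_def untf_def)
  have tight: "(\<Sum>i\<in>UNIV. outer (v i) (v i)) = (real CARD('n) / ?r) *\<^sub>R mat 1"
    using etf by (simp add: etf_def untf_def)
  have trace: "outer (v i) (v i) \<bullet> mat 1 = 1" for i
    by (simp add: inner_outer_diag_matrix sum_cmod_square_unit[OF unit] flip: diag_matrix_1)
  have id_id: "(mat 1 :: complex ^ 'r ^ 'r) \<bullet> mat 1 = ?r"
    by (simp add: inner_diag_matrix flip: diag_matrix_1) (simp add: inner_vec_def)
  have inner_A: "A i \<bullet> A j = (cmod (hinner (v i) (v j)))\<^sup>2 - 1 / ?r" for i j
    by (simp add: A_def inner_diff_left inner_diff_right inner_outer_outer id_id trace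
        trace[unfolded inner_commute[of _ "mat 1"]])
  have "hinner (v i) (v i) = 1" for i
  proof -
    have "hinner (v i) (v i) = complex_of_real (\<Sum>k\<in>UNIV. (cmod (v i $ k))\<^sup>2)"
      by (simp only: hinner_def of_real_sum complex_norm_square)
    then show ?thesis
      by (simp add: sum_cmod_square_unit[OF unit])
  qed
  then have norm_A: "A i \<bullet> A i = 1 - 1 / ?r" for i
    by (simp add: inner_A)
  have angle_A: "A i \<bullet> A j = \<alpha>\<^sup>2 - 1 / ?r" if "i \<noteq> j" for i j
    by (simp add: inner_A \<alpha>[OF that])
  have sum_A: "(\<Sum>i\<in>UNIV. A i) = 0"
    by (simp add: A_def sum_subtractf tight sum_constant_scaleR del: sum_constant)
  have "mat 1 \<bullet> diag_matrix z = 0"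
    using z by (simp add: inner_diag_matrix flip: diag_matrix_1) (simp add: inner_vec_def)
  then have inner_A_z: "A i \<bullet> diag_matrix z = (\<Sum>k\<in>UNIV. (cmod (v i $ k))\<^sup>2 * z $ k)" for i
    by (simp add: A_def inner_diff_left inner_outer_diag_matrix)
  have "norm (diag_matrix z) = norm z"
    by (simp add: norm_eq_sqrt_inner inner_diag_matrix)
  then show ?bound
    using simplex_frame_bound[OF norm_A angle_A sum_A card, of "diag_matrix z"]
    by (simp add: inner_A_z)
  show ?sum
    using sum_A by (simp flip: inner_A_z inner_sum_left)
qed

lemma quadratic_form_gram:
  fixes B :: "real ^ 'n ^ 'm"
  shows "x \<bullet> ((B ** transpose B) *v x) = (\<Sum>i\<in>UNIV. (\<Sum>k\<in>UNIV. B $ k $ i * x $ k)\<^sup>2)"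
proof -
  have "x \<bullet> ((B ** transpose B) *v x) = (transpose B *v x) \<bullet> (transpose B *v x)"
    by (simp add: dot_lmul_matrix vector_transpose_matrix flip: matrix_vector_mul_assoc)
  then show ?thesis
    by (simp add: inner_vec_def matrix_vector_mult_def transpose_def power2_eq_square)
qed

lemma quadratic_form_ones_matrix:
  "x \<bullet> (ones_matrix *v x) = (\<Sum>k\<in>UNIV. x $ k)\<^sup>2"
  by (simp add: inner_vec_def matrix_vector_mult_def ones_matrix_entries power2_eq_square
      flip: sum_distrib_right)

theorem theorem3p1:
  fixes v :: "'n::finite \<Rightarrow> complex ^ 'r"
    and V :: "complex ^ 'n ^ 'r"
    and R :: "real ^ 'r ^ 'r"
    and N r :: real
  assumes N: "N = real CARD('n)"
    and r: "r = real CARD('r)"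
    and N_ge_2: "CARD('n) \<ge> 2"
    and etf: "etf v"
    and V: "V = frame_matrix v"
    and R: "R = abs_sq_matrix V ** transpose (abs_sq_matrix V)"
  shows "R \<preceq> ((1 - 1 / r) / (1 - 1 / N)) *\<^sub>R mat 1
    + ((N / r - 1) / (r * (1 - 1 / N))) *\<^sub>R ones_matrix"
proof -
  define c where "c = (1 - 1 / r) / (1 - 1 / N)"
  define b where "b = (N / r - 1) / (r * (1 - 1 / N))"
  have r_pos: "r > 0" and N2: "N \<ge> 2"
    using N_ge_2 by (simp_all add: r N)
  have b: "b = N / r\<^sup>2 - c / r"
  proof -
    have nz: "N - 1 \<noteq> 0" "N \<noteq> 0" "r \<noteq> 0"
      using r_pos N2 by simp_all
    have "1 - 1 / N = (N - 1) / N"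
      using nz by (simp add: field_simps)
    then show ?thesis
      using nz by (simp add: b_def c_def power2_eq_square divide_simps) (simp add: algebra_simps)
  qed
  have "R $ k $ l = R $ l $ k" for k l
    by (simp add: R V abs_sq_gram_entries mult.commute)
  then have symmetric: "transpose (c *\<^sub>R mat 1 + b *\<^sub>R ones_matrix - R)
      = c *\<^sub>R mat 1 + b *\<^sub>R ones_matrix - R"
    by (auto simp: vec_eq_iff transpose_def ones_matrix_entries mat_def)
  have "x \<bullet> (R *v x) \<le> c * (x \<bullet> x) + b * (\<Sum>k\<in>UNIV. x $ k)\<^sup>2" for x
  proof -
    define t where "t = (\<Sum>k\<in>UNIV. x $ k)"
    define z where "z = x - (\<chi> k. t / r)"
    define w where "w i = (\<Sum>k\<in>UNIV. (cmod (v i $ k))\<^sup>2 * z $ k)" for i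
    have z0: "(\<Sum>k\<in>UNIV. z $ k) = 0"
      using r_pos by (simp add: z_def sum_subtractf t_def r)
    have w_bound: "(\<Sum>i\<in>UNIV. (w i)\<^sup>2) \<le> c * (norm z)\<^sup>2" and w_sum: "(\<Sum>i\<in>UNIV. w i) = 0"
      using etf_diagonal_bound[OF etf N_ge_2 z0] by (simp_all add: w_def c_def N r)
    have x: "(\<Sum>k\<in>UNIV. (cmod (v i $ k))\<^sup>2 * x $ k) = w i + t / r" for i
    proof -
      have "norm (v i) = 1"
        using etf by (simp add: etf_def untf_def)
      then show ?thesis
        by (simp add: w_def z_def right_diff_distrib sum_subtractf sum_cmod_square_unit
            flip: sum_distrib_right sum_divide_distrib)
    qed
    \<comment> \<open>Removing the mean from \<open>x\<close> is an orthogonal projection, whence Pythagoras.\<close>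
    have "(norm z)\<^sup>2 = (\<Sum>k\<in>UNIV. x $ k * x $ k - 2 * (t / r) * x $ k + (t / r)\<^sup>2)"
      unfolding power2_norm_eq_inner
      by (simp add: inner_vec_def z_def power2_eq_square algebra_simps)
    also have "\<dots> = x \<bullet> x - 2 * (t / r) * t + r * (t / r)\<^sup>2"
      by (simp only: sum.distrib sum_subtractf sum_distrib_left[symmetric] t_def)
        (simp add: inner_vec_def r)
    also have "\<dots> = x \<bullet> x - t\<^sup>2 / r"
      using r_pos by (simp add: power2_eq_square field_simps)
    finally have norm_z: "(norm z)\<^sup>2 = x \<bullet> x - t\<^sup>2 / r" .
    have "x \<bullet> (R *v x) = (\<Sum>i\<in>UNIV. (w i + t / r)\<^sup>2)"
      by (simp add: R V quadratic_form_gram x[symmetric] abs_sq_matrix_def frame_matrix_def)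
    also have "\<dots> = (\<Sum>i\<in>UNIV. (w i)\<^sup>2 + 2 * (t / r) * w i + (t / r)\<^sup>2)"
      by (simp add: power2_sum algebra_simps)
    also have "\<dots> = (\<Sum>i\<in>UNIV. (w i)\<^sup>2) + N * (t / r)\<^sup>2"
      by (simp only: sum.distrib sum_distrib_left[symmetric] w_sum) (simp add: N)
    also have "\<dots> \<le> c * (x \<bullet> x - t\<^sup>2 / r) + N * (t / r)\<^sup>2"
      using w_bound by (simp add: norm_z)
    also have "\<dots> = c * (x \<bullet> x) + b * t\<^sup>2"
      by (simp add: b power_divide algebra_simps)
    finally show ?thesis
      by (simp add: t_def)
  qed
  then have "0 \<le> x \<bullet> ((c *\<^sub>R mat 1 + b *\<^sub>R ones_matrix - R) *v x)" for x
    by (simp add: matrix_vector_mult_diff_rdistrib matrix_vector_mult_add_rdistrib inner_add_right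
        inner_diff_right quadratic_form_ones_matrix flip: scaleR_matrix_vector_assoc)
  then show ?thesis
    using symmetric by (simp add: loewner_le_def psd_def c_def b_def)
qed

end
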